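(* Let $S$ be a finite set, let $P$ be an irreducible stochastic matrix on $S$ with stationary distribution $\pi$, and let $f:S\to\mathbb{R}$. Put $b:=\max_{x\in S} f(x)$ and $S_b:=\{x\in S: f(x)=b\}$, and assume that (i) the submatrix of $P$ with rows and columns in $S_b$ is irreducible, and (ii) for every $x\in S\setminus S_b$ there exists $y\in S_b$ such that $P(x,y)>0$. Then, for any initial distribution $q$ on $S$ and every $n\ge 1$, $$\mathbb{P}_q\left(\frac1n\sum_{k=1}^n f(X_k)\ge \mu\right)\le K_u\, e^{-n\Lambda^*(\mu)},\quad\text{for all } \mu\ge \pi(f),$$ where $K_u=K_u(P,f):=\sup_{\theta\ge 0,\;x,y\in S}\frac{v_\theta(x)}{v_\theta(y)}$ is a finite constant depending only on $P$ and $f$.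
   Context: A square nonnegative matrix $A$ is irreducible if for all indices $x,y$ there is $n\ge1$ with $A^n(x,y)>0$ (in particular the $1\times1$ zero matrix is not irreducible). $\mathbb{P}_q$ is the law of the Markov chain $(X_k)_{k\ge0}$ on $S$ with $X_0\sim q$ and transition probability matrix $P$. $\pi(f):=\sum_x f(x)\pi(x)$. For $\theta\in\mathbb{R}$ let $\tilde P_\theta(x,y):=P(x,y)e^{\theta f(y)}$, which is nonnegative and irreducible; let $\rho(\theta)$ be its spectral radius (Perron-Frobenius eigenvalue), and let $u_\theta,v_\theta$ be the unique entrywise positive left and right eigenvectors of $\tilde P_\theta$ for the eigenvalue $\rho(\theta)$ with $\sum_x u_\theta(x)=1$ and $\sum_x u_\theta(x)v_\theta(x)=1$. $\Lambda(\theta):=\log\rho(\theta)$ and $\Lambda^*(\mu):=\sup_{\theta\in\mathbb{R}}\{\theta\mu-\Lambda(\theta)\}\in[0,\infty]$, with the convention $e^{-\infty}=0$. *)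

theory Defs
  imports "HOL-Probability.Probability"
begin

text \<open>
  Entries, for \<open>x, y \<in> T\<close>, of the \<open>n\<close>-th power of the submatrix of \<open>A\<close> with rows and columns
  in \<open>T\<close>. The ring structure on the type \<open>real^'s^'s\<close> is componentwise, so \<open>A ^ n\<close> is not
  the matrix power.
\<close>

primrec submatrix_pow :: "real^'s^'s \<Rightarrow> 's set \<Rightarrow> nat \<Rightarrow> 's \<Rightarrow> 's \<Rightarrow> real" where
  "submatrix_pow A T 0 x y = (if x = y then 1 else 0)"
| "submatrix_pow A T (Suc n) x y = (\<Sum>z\<in>T. A $ x $ z * submatrix_pow A T n z y)"

text \<open>
  Irreducibility of the submatrix of \<open>A\<close> with index set \<open>T\<close>; nonnegativity of \<open>A\<close> is not included
  and comes from \<open>A\<close> being stochastic.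
\<close>

definition irreducible_on :: "'s set \<Rightarrow> real^'s^'s \<Rightarrow> bool" where
  "irreducible_on T A \<longleftrightarrow> (\<forall>x\<in>T. \<forall>y\<in>T. \<exists>n\<ge>1. submatrix_pow A T n x y > 0)"

definition prob_vector :: "real^'s::finite \<Rightarrow> bool" where
  "prob_vector q \<longleftrightarrow> (\<forall>x. q $ x \<ge> 0) \<and> (\<Sum>x\<in>UNIV. q $ x) = 1"

definition stochastic_matrix :: "real^'s::finite^'s \<Rightarrow> bool" where
  "stochastic_matrix P \<longleftrightarrow> (\<forall>x. prob_vector (P $ x))"

definition stationary_distribution :: "real^'s::finite^'s \<Rightarrow> real^'s \<Rightarrow> bool" where
  "stationary_distribution P p \<longleftrightarrow> prob_vector p \<and> p v* P = p"

definition mean :: "real^'s::finite \<Rightarrow> ('s \<Rightarrow> real) \<Rightarrow> real" where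
  "mean p f = (\<Sum>x\<in>UNIV. f x * p $ x)"

definition argmax_set :: "('s::finite \<Rightarrow> real) \<Rightarrow> 's set" where
  "argmax_set f = {x. f x = Max (range f)}"

text \<open>
  \<open>X\<close> is a Markov chain on \<open>M\<close> with \<open>X 0\<close> distributed as \<open>q\<close> and transition matrix \<open>P\<close>. The last
  conjunct is the Markov property
  \<open>\<P>(X (n+1) = x (n+1) | X 0 = x 0, \<dots>, X n = x n) = P (x n) (x (n+1))\<close>
  multiplied out, so that conditioning events of probability zero need no special treatment.
\<close>

definition markov_chain ::
  "'a measure \<Rightarrow> (nat \<Rightarrow> 'a \<Rightarrow> 's::finite) \<Rightarrow> real^'s \<Rightarrow> real^'s^'s \<Rightarrow> bool" where
  "markov_chain M X q P \<longleftrightarrow>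
     prob_space M \<and>
     (\<forall>k. X k \<in> measurable M (count_space UNIV)) \<and>
     (\<forall>x. measure M {\<omega> \<in> space M. X 0 \<omega> = x} = q $ x) \<and>
     (\<forall>n x. measure M {\<omega> \<in> space M. \<forall>i\<le>Suc n. X i \<omega> = x i} =
            measure M {\<omega> \<in> space M. \<forall>i\<le>n. X i \<omega> = x i} * P $ x n $ x (Suc n))"

definition tilted :: "real^'s::finite^'s \<Rightarrow> ('s \<Rightarrow> real) \<Rightarrow> real \<Rightarrow> real^'s^'s" where
  "tilted P f \<theta> = (\<chi> x y. P $ x $ y * exp (\<theta> * f y))"

definition spectrum :: "real^'s::finite^'s \<Rightarrow> complex set" where
  "spectrum A = {c. \<exists>w. w \<noteq> 0 \<and> (\<chi> x y. complex_of_real (A $ x $ y)) *v w = c *s w}"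

definition spectral_radius :: "real^'s::finite^'s \<Rightarrow> real" where
  "spectral_radius A = (SUP c\<in>spectrum A. cmod c)"

definition left_pf_vector :: "real^'s::finite^'s \<Rightarrow> real^'s" where
  "left_pf_vector A = (THE u. (\<forall>x. u $ x > 0) \<and>
     u v* A = spectral_radius A *s u \<and> (\<Sum>x\<in>UNIV. u $ x) = 1)"

definition right_pf_vector :: "real^'s::finite^'s \<Rightarrow> real^'s" where
  "right_pf_vector A = (THE v. (\<forall>x. v $ x > 0) \<and>
     A *v v = spectral_radius A *s v \<and> (\<Sum>x\<in>UNIV. left_pf_vector A $ x * v $ x) = 1)"

definition log_pf :: "real^'s::finite^'s \<Rightarrow> ('s \<Rightarrow> real) \<Rightarrow> real \<Rightarrow> real" where
  "log_pf P f \<theta> = ln (spectral_radius (tilted P f \<theta>))"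

definition rate_function :: "real^'s::finite^'s \<Rightarrow> ('s \<Rightarrow> real) \<Rightarrow> real \<Rightarrow> ereal" where
  "rate_function P f \<mu> = (SUP \<theta>. ereal (\<theta> * \<mu> - log_pf P f \<theta>))"

definition exp_ereal :: "ereal \<Rightarrow> ereal" where
  "exp_ereal z = (case z of ereal x \<Rightarrow> ereal (exp x) | PInfty \<Rightarrow> \<infinity> | MInfty \<Rightarrow> 0)"

definition K_u :: "real^'s::finite^'s \<Rightarrow> ('s \<Rightarrow> real) \<Rightarrow> ereal" where
  "K_u P f = (SUP (\<theta>, x, y) \<in> {0..} \<times> UNIV \<times> UNIV.
     ereal (right_pf_vector (tilted P f \<theta>) $ x / right_pf_vector (tilted P f \<theta>) $ y))"

end

(*
  Chernoff's method: for every \<theta> \<ge> 0 the right eigenvector v of the tilted matrix is comparable to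
  the constant 1 up to the factor K_u, so the exponential moment of the sum is at most
  K_u * \<rho>(\<theta>) ^ n. Jensen's inequality gives \<theta> * \<pi>(f) \<le> \<Lambda>(\<theta>) for all \<theta>, so negative \<theta> do not
  contribute to the rate function when \<mu> \<ge> \<pi>(f). That K_u is finite follows from Harnack inequalities
  for v that are uniform in \<theta>: off a bounded interval of \<theta> they compare every value of v with its
  values on the maximisers of f.
*)

theory Submission
  imports Defs
begin

subsection \<open>Perron--Frobenius theory\<close>

text \<open>Cuts replace matrix powers here: the condition depends only on the signs of the entries,
  so it passes easily to transposes and tilted matrices. For a one-element index type the cut
  condition is vacuous.\<close>

definition irreducible_nonneg :: "real^'s::finite^'s \<Rightarrow> bool" where
  "irreducible_nonneg A \<longleftrightarrow> (\<forall>x y. A $ x $ y \<ge> 0) \<and>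
     (\<forall>Z. Z \<noteq> {} \<longrightarrow> Z \<noteq> UNIV \<longrightarrow> (\<exists>x\<in>Z. \<exists>y\<in>-Z. A $ x $ y > 0))"

text \<open>A set \<open>Z\<close> without an edge to its complement traps every path, so all powers
  vanish from \<open>Z\<close> to its complement.\<close>

lemma irreducible_nonnegI:
  fixes A :: "real^'s::finite^'s"
  assumes nonneg: "\<And>x y. A $ x $ y \<ge> 0" and irred: "irreducible_on UNIV A"
  shows "irreducible_nonneg A"
  unfolding irreducible_nonneg_def
proof (intro conjI allI impI nonneg)
  fix Z :: "'s set" assume "Z \<noteq> {}" "Z \<noteq> UNIV"
  then obtain a b where a: "a \<in> Z" and b: "b \<notin> Z" by auto
  show "\<exists>x\<in>Z. \<exists>y\<in>-Z. A $ x $ y > 0"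
  proof (rule ccontr)
    assume "\<not> ?thesis"
    then have zero: "A $ x $ y = 0" if "x \<in> Z" "y \<notin> Z" for x y
      using nonneg[of x y] that by force
    have "submatrix_pow A UNIV n x b = 0" if "x \<in> Z" for n x
      using that
    proof (induction n arbitrary: x)
      case 0
      with b show ?case by auto
    next
      case (Suc n)
      show ?case
        unfolding submatrix_pow.simps
      proof (intro sum.neutral ballI)
        fix z show "A $ x $ z * submatrix_pow A UNIV n z b = 0"
          by (cases "z \<in> Z") (simp_all add: Suc zero)
      qed
    qed
    with a irred show False unfolding irreducible_on_def by (metis UNIV_I less_irrefl)
  qed
qed

text \<open>An edge of the transpose out of \<open>Z\<close> is an edge of \<open>A\<close> out of
  \<open>-Z\<close>, reversed.\<close>

lemma irreducible_nonneg_transpose: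
  fixes A :: "real^'s::finite^'s"
  assumes "irreducible_nonneg A"
  shows "irreducible_nonneg (transpose A)"
proof -
  have "\<exists>x\<in>Z. \<exists>y\<in>-Z. A $ y $ x > 0" if "Z \<noteq> {}" "Z \<noteq> UNIV" for Z
  proof -
    have "-Z \<noteq> {}" "-Z \<noteq> UNIV" using that by auto
    then obtain x y where "x \<in> -Z" "y \<in> -(-Z)" "A $ x $ y > 0"
      using assms unfolding irreducible_nonneg_def by blast
    then show ?thesis by auto
  qed
  with assms show ?thesis
    by (simp add: irreducible_nonneg_def transpose_def)
qed

lemma irreducible_nonneg_tilted:
  "irreducible_nonneg P \<Longrightarrow> irreducible_nonneg (tilted P f \<theta>)"
  by (simp add: irreducible_nonneg_def tilted_def zero_less_mult_iff)

text \<open>At a zero of \<open>w\<close> the eigenvalue equation makes a sum of nonnegative terms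
  vanish, so no edge leaves the zero set of \<open>w\<close>. By irreducibility that set is
  empty.\<close>

lemma nonneg_eigenvector_pos:
  fixes A :: "real^'s::finite^'s"
  assumes A: "irreducible_nonneg A" and w: "\<And>x. w $ x \<ge> 0" "w \<noteq> 0"
    and eig: "A *v w = l *s w"
  shows "w $ x > 0"
proof (rule ccontr)
  assume "\<not> w $ x > 0"
  let ?Z = "{z. w $ z = 0}"
  have "?Z \<noteq> {}" using \<open>\<not> w $ x > 0\<close> w(1)[of x] by force
  moreover have "?Z \<noteq> UNIV" using w(2) by (auto simp: vec_eq_iff)
  ultimately obtain a b where ab: "w $ a = 0" "w $ b \<noteq> 0" "A $ a $ b > 0"
    using A unfolding irreducible_nonneg_def by blast
  have "0 < A $ a $ b * w $ b" using ab w(1)[of b] by simp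
  also have "\<dots> \<le> (\<Sum>j\<in>UNIV. A $ a $ j * w $ j)"
    using A w(1) by (intro member_le_sum) (auto simp: irreducible_nonneg_def)
  also have "\<dots> = (A *v w) $ a" by (simp add: matrix_vector_mult_def)
  also have "\<dots> = 0" using eig ab by simp
  finally show False by simp
qed

text \<open>
  Brouwer's theorem for \<open>x \<mapsto> (x + A x) / \<parallel>x + A x\<parallel>\<^sub>1\<close> on the simplex; adding \<open>x\<close> keeps the
  denominator positive even if \<open>A x = 0\<close>.
\<close>

lemma pos_eigenvector_exists:
  fixes A :: "real^'s::finite^'s"
  assumes A: "irreducible_nonneg A"
  shows "\<exists>l w. (\<forall>x. w $ x > 0) \<and> A *v w = l *s w"
proof -
  define S where "S = {w::real^'s. (\<forall>x. w $ x \<ge> 0) \<and> (\<Sum>x\<in>UNIV. w $ x) = 1}"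
  define s where "s w = (\<Sum>x\<in>UNIV. (w + A *v w) $ x)" for w
  define F where "F w = (1 / s w) *\<^sub>R (w + A *v w)" for w
  have Aw: "(A *v w) $ x \<ge> 0" if "w \<in> S" for w x
    using that A unfolding S_def irreducible_nonneg_def matrix_vector_mult_def
    by (auto intro!: sum_nonneg)
  have s: "s w \<ge> 1" if "w \<in> S" for w
    using that Aw[OF that] by (auto simp: s_def S_def sum.distrib intro!: sum_nonneg)
  have "S = {w. \<forall>x. w $ x \<ge> 0} \<inter> {w. (\<Sum>x\<in>UNIV. w $ x) = 1}"
    by (auto simp: S_def)
  moreover have "closed {w::real^'s. \<forall>x. w $ x \<ge> 0}"
    by (intro closed_Collect_all closed_Collect_le continuous_intros)
  moreover have "closed {w::real^'s. (\<Sum>x\<in>UNIV. w $ x) = 1}"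
    by (intro closed_Collect_eq continuous_intros)
  ultimately have "closed S" by auto
  moreover have "S \<subseteq> cbox 0 1"
  proof
    fix w assume w: "w \<in> S"
    have "w $ x \<le> (\<Sum>x\<in>UNIV. w $ x)" for x
      using w by (intro member_le_sum) (auto simp: S_def)
    with w show "w \<in> cbox 0 1" by (auto simp: S_def mem_box_cart)
  qed
  ultimately have "compact S"
    by (meson bounded_cbox bounded_subset compact_eq_bounded_closed)
  moreover have "convex S"
    by (auto simp: S_def convex_def sum.distrib simp flip: sum_distrib_left)
  moreover have "S \<noteq> {}"
  proof -
    have "(\<chi> x. 1 / real CARD('s)) \<in> S" by (simp add: S_def)
    then show ?thesis by blast
  qed
  moreover have "continuous_on S F"
    unfolding F_def s_def
    by (intro continuous_intros linear_continuous_on matrix_vector_mul_bounded_linear)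
      (use s in \<open>force simp: s_def\<close>)
  moreover have "F \<in> S \<rightarrow> S"
  proof
    fix w assume w: "w \<in> S"
    have "(\<Sum>x\<in>UNIV. F w $ x) = (1 / s w) * s w"
      by (simp only: F_def s_def vector_scaleR_component real_scaleR_def sum_distrib_left)
    moreover have "F w $ x \<ge> 0" for x
      using s[OF w] Aw[OF w, of x] w by (simp add: F_def S_def)
    ultimately show "F w \<in> S" using s[OF w] by (simp add: S_def)
  qed
  ultimately obtain w where w: "w \<in> S" "F w = w" using brouwer by metis
  \<comment> \<open>Clearing the denominator in the fixed point equation gives the eigenvalue
    \<open>s w - 1\<close>; the 1 is the shift caused by adding \<open>x\<close> to
    \<open>A x\<close>.\<close>
  have "s w *\<^sub>R F w = w + A *v w" using s[OF w(1)] by (simp add: F_def)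
  then have "A *v w = s w *\<^sub>R w - w" using w by (simp add: algebra_simps)
  then have eig: "A *v w = (s w - 1) *s w" by (simp add: vec_eq_iff algebra_simps)
  moreover have "w \<noteq> 0" using w(1) by (auto simp: S_def)
  ultimately have "\<forall>x. w $ x > 0"
    using nonneg_eigenvector_pos[OF A _ _ eig] w(1) by (simp add: S_def)
  with eig show ?thesis by blast
qed

text \<open>Subtract from \<open>w\<close> the largest multiple of \<open>v\<close> that stays below
  it. The difference is a nonnegative eigenvector with a zero entry, hence zero by
  \<open>nonneg_eigenvector_pos\<close>.\<close>

lemma pos_eigenvector_unique:
  fixes A :: "real^'s::finite^'s"
  assumes A: "irreducible_nonneg A"
    and v: "\<And>x. v $ x > 0" "A *v v = l *s v"
    and w: "\<And>x. w $ x > 0" "A *v w = l *s w"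
  shows "\<exists>t. w = t *s v"
proof -
  define t where "t = Min (range (\<lambda>x. w $ x / v $ x))"
  have "t \<in> range (\<lambda>x. w $ x / v $ x)" unfolding t_def by (intro Min_in) auto
  then obtain x where x: "t = w $ x / v $ x" by blast
  have "w $ y \<ge> t * v $ y" for y
  proof -
    have "t \<le> w $ y / v $ y" unfolding t_def by (intro Min_le) auto
    then show ?thesis using v(1)[of y] by (simp add: field_simps)
  qed
  moreover have "A *v (w - t *s v) = l *s (w - t *s v)"
    using v w by (simp add: matrix_vector_mult_diff_distrib vector_scalar_commute vec_eq_iff
      algebra_simps)
  moreover have "\<not> (w - t *s v) $ x > 0" using x v(1)[of x] by simp
  ultimately have "w - t *s v = 0"
    using nonneg_eigenvector_pos[OF A, of "w - t *s v" l x] by fastforce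
  then show ?thesis by auto
qed

text \<open>Evaluate the pairing of \<open>u\<close>, \<open>A\<close> and \<open>w\<close> from
  both sides and cancel the positive number \<open>u \<bullet> w\<close>.\<close>

lemma left_right_eigenvalue_eq:
  fixes A :: "real^'s::finite^'s"
  assumes u: "\<And>x. u $ x > 0" "u v* A = l *s u"
    and w: "\<And>x. w $ x > 0" "A *v w = m *s w"
  shows "l = m"
proof -
  have "l * (u \<bullet> w) = (u v* A) \<bullet> w" by (simp add: u scalar_mult_eq_scaleR)
  also have "\<dots> = u \<bullet> (A *v w)" by (simp add: dot_lmul_matrix)
  also have "\<dots> = m * (u \<bullet> w)" by (simp add: w scalar_mult_eq_scaleR)
  finally have "l * (u \<bullet> w) = m * (u \<bullet> w)" .
  moreover have "u \<bullet> w > 0"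
    unfolding inner_vec_def using u w by (intro sum_pos) auto
  ultimately show ?thesis by simp
qed

text \<open>The vector \<open>w\<close> puts \<open>l\<close> into the spectrum. For a complex
  eigenvector the triangle inequality bounds \<open>cmod c\<close> times its entrywise modulus by
  \<open>A\<close> applied to that modulus; pairing with the positive \<open>u\<close> gives
  \<open>cmod c \<le> l\<close>.\<close>

lemma spectral_radius_eq:
  fixes A :: "real^'s::finite^'s"
  assumes A: "irreducible_nonneg A"
    and u: "\<And>x. u $ x > 0" "u v* A = l *s u"
    and w: "\<And>x. w $ x > 0" "A *v w = l *s w"
  shows "spectral_radius A = l"
  unfolding spectral_radius_def
proof (rule cSup_eq_maximum)
  let ?C = "\<chi> x y. complex_of_real (A $ x $ y)"
  let ?w = "\<chi> x. complex_of_real (w $ x)"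
  have Aw: "(\<Sum>y\<in>UNIV. A $ x $ y * w $ y) = l * w $ x" for x
    using arg_cong[OF w(2), of "\<lambda>v. v $ x"] by (simp add: matrix_vector_mult_def)
  have uA: "(\<Sum>x\<in>UNIV. A $ x $ y * u $ x) = l * u $ y" for y
    using arg_cong[OF u(2), of "\<lambda>v. v $ y"]
    by (simp add: vector_matrix_mult_def mult.commute)
  have Ann: "A $ x $ y \<ge> 0" for x y using A by (simp add: irreducible_nonneg_def)
  have "?C *v ?w = complex_of_real l *s ?w"
    by (simp add: vec_eq_iff matrix_vector_mult_def Aw flip: of_real_mult of_real_sum)
  moreover have "?w \<noteq> 0" using w(1) by (simp add: vec_eq_iff) (metis less_irrefl)
  ultimately have "complex_of_real l \<in> spectrum A" unfolding spectrum_def by blast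
  \<comment> \<open>Without this, \<open>cmod\<close> of the complex number \<open>l\<close> need
    not equal \<open>l\<close>. The index \<open>undefined\<close> is arbitrary.\<close>
  moreover have "l \<ge> 0"
  proof -
    have "0 \<le> (\<Sum>y\<in>UNIV. A $ undefined $ y * w $ y)"
      using Ann w(1) by (intro sum_nonneg) (simp add: less_imp_le)
    then show ?thesis using Aw[of undefined] w(1)[of undefined] by (simp add: zero_le_mult_iff)
  qed
  ultimately show "l \<in> cmod ` spectrum A"
    by (intro image_eqI[of _ _ "complex_of_real l"]) auto
  fix r assume "r \<in> cmod ` spectrum A"
  then obtain c z where r: "r = cmod c" and z: "z \<noteq> 0" "?C *v z = c *s z"
    unfolding spectrum_def by auto
  have le: "cmod c * cmod (z $ x) \<le> (\<Sum>y\<in>UNIV. A $ x $ y * cmod (z $ y))" for x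
  proof -
    have "cmod c * cmod (z $ x) = cmod ((?C *v z) $ x)" by (simp add: z norm_mult)
    also have "\<dots> \<le> (\<Sum>y\<in>UNIV. cmod (complex_of_real (A $ x $ y) * z $ y))"
      unfolding matrix_vector_mult_def by (simp add: norm_sum)
    also have "\<dots> = (\<Sum>y\<in>UNIV. A $ x $ y * cmod (z $ y))" by (simp add: norm_mult Ann)
    finally show ?thesis .
  qed
  define s where "s = (\<Sum>x\<in>UNIV. u $ x * cmod (z $ x))"
  obtain x0 where "z $ x0 \<noteq> 0" using z(1) by (auto simp: vec_eq_iff)
  then have "s > 0"
    unfolding s_def using u(1) by (intro sum_pos2[of _ x0]) (auto simp: less_imp_le)
  have "cmod c * s = (\<Sum>x\<in>UNIV. u $ x * (cmod c * cmod (z $ x)))"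
    by (simp add: s_def sum_distrib_left algebra_simps)
  also have "\<dots> \<le> (\<Sum>x\<in>UNIV. u $ x * (\<Sum>y\<in>UNIV. A $ x $ y * cmod (z $ y)))"
    using u(1) le by (intro sum_mono mult_left_mono) (auto simp: less_imp_le)
  also have "\<dots> = (\<Sum>x\<in>UNIV. \<Sum>y\<in>UNIV. A $ x $ y * u $ x * cmod (z $ y))"
    by (simp add: sum_distrib_left algebra_simps)
  also have "\<dots> = (\<Sum>y\<in>UNIV. \<Sum>x\<in>UNIV. A $ x $ y * u $ x * cmod (z $ y))"
    by (rule sum.swap)
  also have "\<dots> = l * s"
    unfolding sum_distrib_right[symmetric] uA by (simp add: s_def sum_distrib_left mult.assoc)
  finally show "r \<le> l" using \<open>s > 0\<close> r by simp
qed

lemma pf_exists: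
  fixes A :: "real^'s::finite^'s"
  assumes A: "irreducible_nonneg A"
  obtains u w where "\<And>x. u $ x > 0" "u v* A = spectral_radius A *s u"
    and "\<And>x. w $ x > 0" "A *v w = spectral_radius A *s w"
proof -
  obtain l w where w: "\<forall>x. w $ x > 0" "A *v w = l *s w"
    using pos_eigenvector_exists[OF A] by blast
  obtain m u where u: "\<forall>x. u $ x > 0" "u v* A = m *s u"
    using pos_eigenvector_exists[OF irreducible_nonneg_transpose[OF A]]
    by (auto simp: transpose_matrix_vector)
  have "m = l" using left_right_eigenvalue_eq u w by blast
  then have "spectral_radius A = l" using spectral_radius_eq[OF A] u w by blast
  with u w \<open>m = l\<close> that show thesis by auto
qed

text \<open>The definite description is justified: rescaling gives existence,
  \<open>pos_eigenvector_unique\<close> for the transpose gives proportionality, and the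
  normalisation fixes the factor. Positivity then allows the right eigenvector to be normalised
  against this one.\<close>

lemma left_pf_vector_pos:
  fixes A :: "real^'s::finite^'s"
  assumes A: "irreducible_nonneg A"
  shows "left_pf_vector A $ x > 0"
proof -
  obtain u where u: "\<And>x. u $ x > 0" "u v* A = spectral_radius A *s u"
    using pf_exists[OF A] by metis
  define s where "s = (\<Sum>x\<in>UNIV. u $ x)"
  have s: "s > 0" unfolding s_def using u by (intro sum_pos) auto
  let ?Q = "\<lambda>u. (\<forall>x. u $ x > 0) \<and> u v* A = spectral_radius A *s u \<and> (\<Sum>x\<in>UNIV. u $ x) = 1"
  have Q: "?Q ((1 / s) *s u)"
    using u s by (auto simp: s_def vector_matrix_mult_def vec_eq_iff scaleR_sum_right
      algebra_simps simp flip: sum_distrib_left sum_divide_distrib)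
  have "v = (1 / s) *s u" if v: "?Q v" for v
  proof -
    have "\<exists>t. v = t *s ((1 / s) *s u)"
      using Q v
      by (intro pos_eigenvector_unique[OF irreducible_nonneg_transpose[OF A],
            where l = "spectral_radius A"]) (auto simp: transpose_matrix_vector)
    then obtain t where t: "v = t *s ((1 / s) *s u)" by blast
    then have "(\<Sum>x\<in>UNIV. v $ x) = t * (\<Sum>x\<in>UNIV. ((1 / s) *s u) $ x)"
      by (simp add: sum_distrib_left)
    with Q v have "t = 1" by simp
    with t show ?thesis by simp
  qed
  then have "?Q (left_pf_vector A)" unfolding left_pf_vector_def by (rule theI[of ?Q, OF Q])
  then show ?thesis by blast
qed

lemma right_pf_vector:
  fixes A :: "real^'s::finite^'s"
  assumes A: "irreducible_nonneg A"
  shows right_pf_vector_pos: "right_pf_vector A $ x > 0"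
    and right_pf_vector_eigen: "A *v right_pf_vector A = spectral_radius A *s right_pf_vector A"
proof -
  obtain u where u: "\<And>x. u $ x > 0" "A *v u = spectral_radius A *s u"
    using pf_exists[OF A] by metis
  let ?l = "left_pf_vector A"
  define s where "s = (\<Sum>x\<in>UNIV. ?l $ x * u $ x)"
  have s: "s > 0" unfolding s_def using u left_pf_vector_pos[OF A] by (intro sum_pos) auto
  let ?Q = "\<lambda>u. (\<forall>x. u $ x > 0) \<and> A *v u = spectral_radius A *s u \<and>
    (\<Sum>x\<in>UNIV. ?l $ x * u $ x) = 1"
  have Q: "?Q ((1 / s) *s u)"
    using u s by (auto simp: s_def vector_scalar_commute vec_eq_iff simp flip: sum_divide_distrib)
  have "v = (1 / s) *s u" if v: "?Q v" for v
  proof -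
    have "\<exists>t. v = t *s ((1 / s) *s u)"
      using Q v by (intro pos_eigenvector_unique[OF A, where l = "spectral_radius A"]) auto
    then obtain t where t: "v = t *s ((1 / s) *s u)" by blast
    then have "(\<Sum>x\<in>UNIV. ?l $ x * v $ x) = t * (\<Sum>x\<in>UNIV. ?l $ x * ((1 / s) *s u) $ x)"
      by (simp add: sum_distrib_left algebra_simps)
    with Q v have "t = 1" by simp
    with t show ?thesis by simp
  qed
  then have "?Q (right_pf_vector A)" unfolding right_pf_vector_def by (rule theI[of ?Q, OF Q])
  then show "right_pf_vector A $ x > 0" "A *v right_pf_vector A = spectral_radius A *s right_pf_vector A"
    by blast+
qed

subsection \<open>Tilted stochastic matrices\<close>

lemma stochastic_matrix_nonneg: "stochastic_matrix P \<Longrightarrow> P $ x $ y \<ge> 0"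
  and stochastic_matrix_sum: "stochastic_matrix P \<Longrightarrow> (\<Sum>y\<in>UNIV. P $ x $ y) = 1"
  by (auto simp: stochastic_matrix_def prob_vector_def)

context
  fixes P :: "real^'s::finite^'s" and f :: "'s \<Rightarrow> real"
  assumes stoch: "stochastic_matrix P" and irred: "irreducible_on UNIV P"
begin

lemma irreducible_tilted: "irreducible_nonneg (tilted P f \<theta>)"
  using irreducible_nonnegI irreducible_nonneg_tilted irred stochastic_matrix_nonneg[OF stoch]
  by blast

lemma right_pf_tilted_pos: "right_pf_vector (tilted P f \<theta>) $ x > 0"
  by (rule right_pf_vector_pos[OF irreducible_tilted])

lemma right_pf_tilted_eigen:
  "(\<Sum>y\<in>UNIV. P $ x $ y * exp (\<theta> * f y) * right_pf_vector (tilted P f \<theta>) $ y) =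
     spectral_radius (tilted P f \<theta>) * right_pf_vector (tilted P f \<theta>) $ x"
  using arg_cong[OF right_pf_vector_eigen[OF irreducible_tilted], of "\<lambda>v. v $ x" \<theta>]
  by (simp add: matrix_vector_mult_def tilted_def)

text \<open>This makes \<open>log_pf\<close> a genuine logarithm. A row of \<open>P\<close> sums to
  one, so it has a positive entry, and the eigenvalue equation at that row has a positive left-hand
  side.\<close>

lemma spectral_radius_tilted_pos: "spectral_radius (tilted P f \<theta>) > 0"
proof -
  let ?v = "right_pf_vector (tilted P f \<theta>)" and ?x = "undefined :: 's"
  obtain y where "P $ ?x $ y \<noteq> 0"
    using stochastic_matrix_sum[OF stoch, of ?x] by (metis sum.neutral zero_neq_one)
  then have y: "P $ ?x $ y > 0" using stochastic_matrix_nonneg[OF stoch, of ?x y] by simp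
  have "0 < (\<Sum>y\<in>UNIV. P $ ?x $ y * exp (\<theta> * f y) * ?v $ y)"
    using y right_pf_tilted_pos stochastic_matrix_nonneg[OF stoch]
    by (intro sum_pos2[of _ y]) (auto simp: less_imp_le)
  then show ?thesis
    using right_pf_tilted_pos[of \<theta> ?x] by (simp add: right_pf_tilted_eigen zero_less_mult_iff)
qed

text \<open>
  Jensen's inequality for \<open>ln\<close>, applied to each row of the eigenvalue equation and then averaged
  over \<open>\<pi>\<close>; the terms \<open>\<pi>(ln v)\<close> cancel by stationarity.
\<close>

lemma log_pf_ge_mean:
  assumes stat: "stationary_distribution P \<pi>"
  shows "\<theta> * mean \<pi> f \<le> log_pf P f \<theta>"
proof -
  let ?v = "\<lambda>x. right_pf_vector (tilted P f \<theta>) $ x" and ?L = "log_pf P f \<theta>"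
  note v = right_pf_tilted_pos[of \<theta>]
  have \<pi>: "\<pi> $ x \<ge> 0" "(\<Sum>x\<in>UNIV. \<pi> $ x) = 1" for x
    using stat by (auto simp: stationary_distribution_def prob_vector_def)
  have inv: "(\<Sum>x\<in>UNIV. \<pi> $ x * P $ x $ y) = \<pi> $ y" for y
  proof -
    have "\<pi> v* P = \<pi>" using stat by (simp add: stationary_distribution_def)
    from arg_cong[OF this, of "\<lambda>v. v $ y"] show ?thesis
      by (simp add: vector_matrix_mult_def mult.commute)
  qed
  have row: "(\<Sum>y\<in>UNIV. P $ x $ y * (\<theta> * f y + ln (?v y))) \<le> ?L + ln (?v x)" for x
  proof -
    have "(\<Sum>y\<in>UNIV. P $ x $ y * ln (exp (\<theta> * f y) * ?v y))
        \<le> ln (\<Sum>y\<in>UNIV. P $ x $ y *\<^sub>R (exp (\<theta> * f y) * ?v y))"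
      using v stochastic_matrix_nonneg[OF stoch] stochastic_matrix_sum[OF stoch]
      by (intro concave_on_sum[OF _ _ ln_concave]) auto
    moreover have "ln (exp (\<theta> * f y) * ?v y) = \<theta> * f y + ln (?v y)" for y
      using v[of y] by (simp add: ln_mult)
    moreover have "ln (\<Sum>y\<in>UNIV. P $ x $ y *\<^sub>R (exp (\<theta> * f y) * ?v y)) = ?L + ln (?v x)"
      using v[of x] spectral_radius_tilted_pos[of \<theta>] right_pf_tilted_eigen[of x \<theta>]
      by (simp add: log_pf_def ln_mult mult.assoc)
    ultimately show ?thesis by simp
  qed
  have avg: "(\<Sum>x\<in>UNIV. \<pi> $ x * (\<Sum>y\<in>UNIV. P $ x $ y * h y)) = (\<Sum>y\<in>UNIV. \<pi> $ y * h y)" for h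
  proof -
    have "(\<Sum>x\<in>UNIV. \<pi> $ x * (\<Sum>y\<in>UNIV. P $ x $ y * h y))
        = (\<Sum>x\<in>UNIV. \<Sum>y\<in>UNIV. \<pi> $ x * P $ x $ y * h y)"
      by (simp add: sum_distrib_left mult.assoc)
    also have "\<dots> = (\<Sum>y\<in>UNIV. \<Sum>x\<in>UNIV. \<pi> $ x * P $ x $ y * h y)" by (rule sum.swap)
    finally show ?thesis by (simp add: inv flip: sum_distrib_right)
  qed
  have "(\<Sum>x\<in>UNIV. \<pi> $ x * (\<theta> * f x + ln (?v x)))
      = (\<Sum>x\<in>UNIV. \<pi> $ x * (\<Sum>y\<in>UNIV. P $ x $ y * (\<theta> * f y + ln (?v y))))"
    by (rule avg[symmetric])
  also have "\<dots> \<le> (\<Sum>x\<in>UNIV. \<pi> $ x * (?L + ln (?v x)))"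
    by (intro sum_mono mult_left_mono row \<pi>)
  also have "\<dots> = ?L + (\<Sum>x\<in>UNIV. \<pi> $ x * ln (?v x))"
    using \<pi>(2) by (simp add: distrib_left sum.distrib flip: sum_distrib_right)
  finally show ?thesis
    by (simp add: distrib_left sum.distrib mean_def sum_distrib_left algebra_simps)
qed

end

subsection \<open>Uniform comparison of the eigenvector entries\<close>

text \<open>Iterate the one-step inequality along paths inside \<open>T\<close> and keep only the
  contribution of paths ending at \<open>y\<close>.\<close>

lemma submatrix_pow_superharmonic:
  fixes A :: "real^'s::finite^'s"
  assumes A: "\<And>x y. A $ x $ y \<ge> 0" and k: "k \<ge> 0" and v: "\<And>x. v x \<ge> 0"
    and super: "\<And>x. x \<in> T \<Longrightarrow> k * (\<Sum>z\<in>T. A $ x $ z * v z) \<le> v x"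
    and "x \<in> T"
  shows "k ^ n * submatrix_pow A T n x y * v y \<le> v x"
  using \<open>x \<in> T\<close>
proof (induction n arbitrary: x)
  case 0
  then show ?case using v by simp
next
  case (Suc n)
  have "k ^ Suc n * submatrix_pow A T (Suc n) x y * v y
      = k * (\<Sum>z\<in>T. A $ x $ z * (k ^ n * submatrix_pow A T n z y * v y))"
    by (simp add: sum_distrib_left sum_distrib_right algebra_simps)
  also have "\<dots> \<le> k * (\<Sum>z\<in>T. A $ x $ z * v z)"
    using Suc.IH A k by (intro mult_left_mono sum_mono) auto
  also have "\<dots> \<le> v x" using super Suc.prems by simp
  finally show ?case .
qed

lemma finite_pos_lower_bound:
  assumes "finite I" "\<And>i. i \<in> I \<Longrightarrow> h i > (0::real)"
  shows "\<exists>c>0. c \<le> 1 \<and> (\<forall>i\<in>I. c \<le> h i)"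
  \<comment> \<open>Inserting 1 keeps the minimum defined when \<open>I\<close> is empty, as happens
    for the complement of \<open>argmax_set f\<close> when \<open>f\<close> is constant.\<close>
  using assms by (intro exI[of _ "Min (insert 1 (h ` I))"]) auto

text \<open>The constant is chosen before \<open>v\<close>, so it serves the eigenvectors for all
  \<theta> at once. It comes from one positive power for each pair and a minimum over the finitely
  many pairs.\<close>

lemma harnack_inequality:
  fixes A :: "real^'s::finite^'s"
  assumes A: "\<And>x y. A $ x $ y \<ge> 0" and irred: "irreducible_on T A" and k: "k > 0"
  shows "\<exists>c>0. \<forall>v. (\<forall>x. v x \<ge> 0) \<longrightarrow> (\<forall>x\<in>T. k * (\<Sum>z\<in>T. A $ x $ z * v z) \<le> v x) \<longrightarrow>
    (\<forall>x\<in>T. \<forall>y\<in>T. c * v y \<le> v x)"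
proof -
  define N where "N x y = (SOME n. submatrix_pow A T n x y > 0)" for x y
  have N: "submatrix_pow A T (N x y) x y > 0" if "x \<in> T" "y \<in> T" for x y
    unfolding N_def by (rule someI_ex) (use irred that in \<open>auto simp: irreducible_on_def\<close>)
  define h where "h = (\<lambda>(x, y). k ^ N x y * submatrix_pow A T (N x y) x y)"
  have "h i > 0" if "i \<in> T \<times> T" for i using that N k by (auto simp: h_def)
  then have "\<exists>c>0. c \<le> 1 \<and> (\<forall>i\<in>T \<times> T. c \<le> h i)"
    by (intro finite_pos_lower_bound finite)
  then obtain c where c: "c > 0" "\<forall>i\<in>T \<times> T. c \<le> h i" by blast
  show ?thesis
  proof (intro exI[of _ c] conjI c(1) allI impI ballI)
    fix v :: "'s \<Rightarrow> real" and x y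
    assume "\<forall>x. v x \<ge> 0" "\<forall>x\<in>T. k * (\<Sum>z\<in>T. A $ x $ z * v z) \<le> v x" and xy: "x \<in> T" "y \<in> T"
    then have *: "\<And>x. v x \<ge> 0" "\<And>x. x \<in> T \<Longrightarrow> k * (\<Sum>z\<in>T. A $ x $ z * v z) \<le> v x" by auto
    have "c * v y \<le> h (x, y) * v y" using c(2) * xy by (intro mult_right_mono) auto
    also have "\<dots> \<le> v x"
      unfolding h_def using submatrix_pow_superharmonic[OF A _ *, of x] xy k by simp
    finally show "c * v y \<le> v x" .
  qed
qed

text \<open>The edge is the first step of a return path to \<open>x\<close>;
  \<open>n \<ge> 1\<close> in the definition of irreducibility excludes the empty path, even if
  \<open>T\<close> is a singleton.\<close>

lemma irreducible_on_edge:
  fixes A :: "real^'s::finite^'s"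
  assumes A: "\<And>x y. A $ x $ y \<ge> 0" and "irreducible_on T A" "x \<in> T"
  obtains z where "z \<in> T" "A $ x $ z > 0"
proof -
  obtain n where "n \<ge> 1" "submatrix_pow A T n x x > 0"
    using assms unfolding irreducible_on_def by blast
  then obtain m where "submatrix_pow A T (Suc m) x x > 0" by (cases n) auto
  then have "(\<Sum>z\<in>T. A $ x $ z * submatrix_pow A T m z x) \<noteq> 0" by simp
  then obtain z where "z \<in> T" "A $ x $ z * submatrix_pow A T m z x \<noteq> 0"
    by (rule sum.not_neutral_contains_not_neutral)
  with that[of z] A[of x z] show thesis by auto
qed

text \<open>
  After division by \<open>exp (\<theta> * Max (range f))\<close> the eigenvalue \<open>l\<close> lies in \<open>[r, 1]\<close> with \<open>r\<close>
  independent of \<open>\<theta>\<close>. The eigenvector is then superharmonic for \<open>P\<close> restricted to \<open>argmax_set f\<close>,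
  so its values there are, up to a factor, lower bounds for all its values. Once the weights off
  \<open>argmax_set f\<close> are at most \<open>r / 2\<close>, its maximum is also at most a multiple of its values on
  \<open>argmax_set f\<close>. The remaining \<open>\<theta>\<close> form a bounded interval, where irreducibility of \<open>P\<close> suffices.
\<close>

lemma right_pf_ratio_bounded:
  fixes P :: "real^'s::finite^'s" and f :: "'s \<Rightarrow> real"
  assumes stoch: "stochastic_matrix P" and irred: "irreducible_on UNIV P"
    and irred_max: "irreducible_on (argmax_set f) P"
    and to_max: "\<forall>x. x \<notin> argmax_set f \<longrightarrow> (\<exists>y\<in>argmax_set f. P $ x $ y > 0)"
  obtains C where "\<And>\<theta> x y. \<theta> \<ge> 0 \<Longrightarrow>
    right_pf_vector (tilted P f \<theta>) $ x / right_pf_vector (tilted P f \<theta>) $ y \<le> C"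
proof -
  note P = stochastic_matrix_nonneg[OF stoch] stochastic_matrix_sum[OF stoch]
  define b where "b = Max (range f)"
  let ?B = "argmax_set f"
  have B: "x \<in> ?B \<longleftrightarrow> f x = b" for x by (simp add: argmax_set_def b_def)
  have fb: "f x \<le> b" for x by (simp add: b_def)
  have "b \<in> range f" unfolding b_def by (intro Max_in) auto
  then obtain b0 where b0: "b0 \<in> ?B" using B by auto
  define d where "d = b - Min (range f)"
  have d: "b - f x \<le> d" for x by (simp add: d_def)
  have "d \<ge> 0" using d[of b0] fb[of b0] by linarith
  have "0 < b - f y" if "y \<in> -?B" for y using that fb[of y] B[of y] by simp
  then have "\<exists>\<delta>>0. \<delta> \<le> 1 \<and> (\<forall>y\<in>-?B. \<delta> \<le> b - f y)"
    by (intro finite_pos_lower_bound finite)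
  then obtain \<delta> where \<delta>: "\<delta> > 0" "\<And>y. y \<notin> ?B \<Longrightarrow> \<delta> \<le> b - f y" by auto
  have "\<exists>p>0. p \<le> 1 \<and> (\<forall>i\<in>{i. P $ fst i $ snd i > 0}. p \<le> P $ fst i $ snd i)"
    by (intro finite_pos_lower_bound finite) simp
  then obtain p where p: "p > 0" "p \<le> 1"
    and p_min: "\<forall>i\<in>{i. P $ fst i $ snd i > 0}. p \<le> P $ fst i $ snd i" by blast
  have p_le: "p \<le> P $ x $ y" if "P $ x $ y > 0" for x y using p_min that by auto
  obtain c where c: "c > 0" and harnack: "\<forall>v. (\<forall>x. v x \<ge> 0) \<longrightarrow>
      (\<forall>x\<in>?B. 1 * (\<Sum>z\<in>?B. P $ x $ z * v z) \<le> v x) \<longrightarrow> (\<forall>x\<in>?B. \<forall>y\<in>?B. c * v y \<le> v x)"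
    using harnack_inequality[OF P(1) irred_max zero_less_one] by blast
  define r where "r = p * c"
  have r: "r > 0" using p c by (simp add: r_def)
  \<comment> \<open>Chosen so that \<open>exp (- (\<Theta> * \<delta>)) \<le> r / 2\<close>: beyond
    \<Theta> every normalised weight off \<open>argmax_set f\<close> is at most
    \<open>r / 2\<close>.\<close>
  define \<Theta> where "\<Theta> = max 0 (- ln (r / 2) / \<delta>)"
  have "- ln (r / 2) / \<delta> \<le> \<Theta>" by (simp add: \<Theta>_def)
  then have \<Theta>: "- ln (r / 2) \<le> \<Theta> * \<delta>" by (simp only: pos_divide_le_eq[OF \<delta>(1)])
  \<comment> \<open>A lower bound for all normalised weights
    \<open>exp (\<theta> * (f y - b))\<close> with \<theta> between 0 and \<Theta>.\<close>
  define k where "k = exp (- (\<Theta> * d))"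
  have "k > 0" by (simp add: k_def)
  obtain c' where c': "c' > 0" and harnack': "\<forall>v. (\<forall>x. v x \<ge> 0) \<longrightarrow>
      (\<forall>x\<in>UNIV. k * (\<Sum>z\<in>UNIV. P $ x $ z * v z) \<le> v x) \<longrightarrow> (\<forall>x\<in>UNIV. \<forall>y\<in>UNIV. c' * v y \<le> v x)"
    using harnack_inequality[OF P(1) irred \<open>k > 0\<close>] by blast
  show thesis
  \<comment> \<open>The first bound is for \<theta> beyond \<Theta>, the second for \<theta> up to
    \<Theta>.\<close>
  proof (rule that[of "max (2 / (r * r)) (1 / c')"])
    fix \<theta> :: real and x1 x2
    assume \<theta>: "\<theta> \<ge> 0"
    define v where "v x = right_pf_vector (tilted P f \<theta>) $ x" for x
    define l where "l = spectral_radius (tilted P f \<theta>) * exp (- (\<theta> * b))"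
    define g where "g y = exp (\<theta> * (f y - b))" for y
    have v: "v x > 0" for x unfolding v_def by (rule right_pf_tilted_pos[OF stoch irred])
    have eig: "l * v x = (\<Sum>y\<in>UNIV. P $ x $ y * g y * v y)" for x
    proof -
      have "(\<Sum>y\<in>UNIV. P $ x $ y * g y * v y)
          = exp (- (\<theta> * b)) * (\<Sum>y\<in>UNIV. P $ x $ y * exp (\<theta> * f y) * v y)"
        by (simp add: g_def sum_distrib_left right_diff_distrib exp_diff exp_minus field_simps)
      then show ?thesis
        unfolding v_def right_pf_tilted_eigen[OF stoch irred] by (simp add: l_def)
    qed
    have g: "g y > 0" "g y \<le> 1" for y
      using \<theta> fb[of y] by (auto simp: g_def mult_nonneg_nonpos)
    have gB: "g y = 1" if "y \<in> ?B" for y using that B by (simp add: g_def)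
    have "Max (range v) \<in> range v" by (intro Max_in) auto
    then obtain m where m: "Max (range v) = v m" by blast
    have vm: "v x \<le> v m" for x unfolding m[symmetric] by (intro Max_ge) auto
    have "Max (v ` ?B) \<in> v ` ?B" using b0 by (intro Max_in) auto
    then obtain y0 where y0: "y0 \<in> ?B" "Max (v ` ?B) = v y0" by blast
    have vB: "v y \<le> v y0" if "y \<in> ?B" for y
      unfolding y0(2)[symmetric] using that by (intro Max_ge) auto
    \<comment> \<open>Read at a maximiser of \<open>v\<close>, the eigenvalue equation with weights
      at most 1 forces \<open>l \<le> 1\<close>.\<close>
    have "l * v m \<le> (\<Sum>y\<in>UNIV. P $ m $ y * v m)"
      unfolding eig
    proof (intro sum_mono)
      fix y show "P $ m $ y * g y * v y \<le> P $ m $ y * v m"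
        using P(1)[of m y] mult_mono[OF g(2) vm, of y y] v[of y] g(1)[of y]
        by (simp add: mult.assoc mult_left_mono less_imp_le)
    qed
    also have "\<dots> = v m" using P(2) by (simp flip: sum_distrib_right)
    finally have "l \<le> 1" using v[of m] by simp
    then have lv: "l * v x \<le> v x" for x using v[of x] by simp
    \<comment> \<open>On \<open>argmax_set f\<close> the weights equal 1; the other terms of the
      eigenvalue equation are nonnegative and are dropped.\<close>
    have onB: "(\<Sum>z\<in>?B. P $ x $ z * v z) \<le> l * v x" for x
    proof -
      have "(\<Sum>z\<in>?B. P $ x $ z * v z) = (\<Sum>z\<in>?B. P $ x $ z * g z * v z)" by (simp add: gB)
      also have "\<dots> \<le> l * v x"
        unfolding eig using P(1) v g by (intro sum_mono2) (auto simp: less_imp_le)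
      finally show ?thesis .
    qed
    have cB: "c * v y \<le> v x" if "x \<in> ?B" "y \<in> ?B" for x y
      using harnack[rule_format, of v x y] that v order_trans[OF onB lv] by (simp add: less_imp_le)
    have edge: "r * v y \<le> l * v x" if "P $ x $ z > 0" "z \<in> ?B" "y \<in> ?B" for x y z
    proof -
      have "r * v y = p * (c * v y)" by (simp add: r_def)
      also have "\<dots> \<le> P $ x $ z * v z"
        using p(1) p_le[OF that(1)] that cB[of z y] c v[of y] by (intro mult_mono) (auto simp: less_imp_le)
      also have "\<dots> \<le> (\<Sum>z\<in>?B. P $ x $ z * v z)"
        using that P(1) v by (intro member_le_sum) (auto simp: less_imp_le)
      also have "\<dots> \<le> l * v x" by (rule onB)
      finally show ?thesis .
    qed
    \<comment> \<open>One step leads from any \<open>x\<close> into \<open>argmax_set f\<close>, by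
      irreducibility of the block or by \<open>to_max\<close>; the Harnack constant \<open>c\<close>
      then reaches every \<open>y\<close> there.\<close>
    have lower: "r * v y \<le> l * v x" if "y \<in> ?B" for x y
    proof -
      obtain z where "z \<in> ?B" "P $ x $ z > 0"
        using to_max irreducible_on_edge[OF P(1) irred_max, of x] by (cases "x \<in> ?B") auto
      with edge that show ?thesis by blast
    qed
    have "r \<le> l" using lower[OF b0, of b0] v[of b0] by simp
    show "right_pf_vector (tilted P f \<theta>) $ x1 / right_pf_vector (tilted P f \<theta>) $ x2
        \<le> max (2 / (r * r)) (1 / c')"
      unfolding v_def[symmetric]
    proof (cases "\<theta> \<le> \<Theta>")
      case True
      have "k * (\<Sum>z\<in>UNIV. P $ x $ z * v z) \<le> v x" for x
      proof -
        have kg: "k \<le> g z" for z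
        proof -
          have "\<theta> * (b - f z) \<le> \<Theta> * d"
            using True \<theta> d[of z] fb[of z] \<open>d \<ge> 0\<close> by (intro mult_mono) auto
          then show ?thesis by (simp add: k_def g_def algebra_simps)
        qed
        have "k * (\<Sum>z\<in>UNIV. P $ x $ z * v z) = (\<Sum>z\<in>UNIV. P $ x $ z * k * v z)"
          by (simp add: sum_distrib_left algebra_simps)
        also have "\<dots> \<le> l * v x"
          unfolding eig using P(1) v kg
          by (intro sum_mono mult_right_mono mult_left_mono) (auto simp: less_imp_le)
        finally show ?thesis using lv[of x] by linarith
      qed
      then have "c' * v x1 \<le> v x2" using harnack'[rule_format, of v x2 x1] v by (simp add: less_imp_le)
      then have "v x1 / v x2 \<le> 1 / c'" using v[of x2] c' by (simp add: field_simps)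
      then show "v x1 / v x2 \<le> max (2 / (r * r)) (1 / c')" by simp
    next
      case False
      have gr: "g y \<le> r / 2" if "y \<notin> ?B" for y
      proof -
        have "- ln (r / 2) \<le> \<theta> * (b - f y)"
          using \<Theta> False \<theta> \<delta>(1) \<delta>(2)[OF that] mult_mono[of \<Theta> \<theta> \<delta> "b - f y"] by simp
        then have "g y \<le> exp (ln (r / 2))" by (simp add: g_def algebra_simps)
        then show ?thesis using r by simp
      qed
      \<comment> \<open>Bound the row at the maximiser \<open>m\<close> by \<open>v y0\<close> on
        \<open>argmax_set f\<close> and by \<open>r / 2 * v m\<close> off it. The latter is absorbed
        into the left-hand side.\<close>
      have "r * v m \<le> l * v m" using \<open>r \<le> l\<close> v[of m] by simp
      also have "\<dots> \<le> (\<Sum>y\<in>UNIV. P $ m $ y * (v y0 + r / 2 * v m))"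
        unfolding eig
      proof (intro sum_mono)
        fix y
        have "g y * v y \<le> v y0 + r / 2 * v m"
        proof (cases "y \<in> ?B")
          case True
          then show ?thesis using gB vB[of y] r v[of m] by (simp add: add_increasing2)
        next
          case False
          then have "g y * v y \<le> r / 2 * v m"
            using gr[of y] vm[of y] v[of y] r by (intro mult_mono) (auto simp: less_imp_le)
          then show ?thesis using v[of y0] by linarith
        qed
        then show "P $ m $ y * g y * v y \<le> P $ m $ y * (v y0 + r / 2 * v m)"
          using P(1)[of m y] by (simp add: mult.assoc mult_left_mono)
      qed
      also have "\<dots> = v y0 + r / 2 * v m" using P(2) by (simp flip: sum_distrib_right)
      finally have "r * v m \<le> 2 * v y0" by simp
      \<comment> \<open>The second factor \<open>r\<close> is the cost of comparing
        \<open>v y0\<close> with the value at an arbitrary state through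
        \<open>lower\<close>.\<close>
      then have "r * (r * v m) \<le> r * (2 * v y0)" using r by (intro mult_left_mono) auto
      also have "\<dots> \<le> 2 * v x2" using lower[OF y0(1), of x2] lv[of x2] by simp
      finally have "r * r * v m \<le> 2 * v x2" by (simp add: mult.assoc)
      moreover have "r * r * v x1 \<le> r * r * v m" using vm r by (intro mult_left_mono) auto
      ultimately have "r * r * v x1 \<le> 2 * v x2" by linarith
      then have "v x1 / v x2 \<le> 2 / (r * r)" using v[of x2] r by (simp add: field_simps)
      then show "v x1 / v x2 \<le> max (2 / (r * r)) (1 / c')" by simp
    qed
  qed
qed

subsection \<open>Exponential moments along paths\<close>

lemma markov_chain_path:
  assumes "markov_chain M X q P"
  shows "measure M {\<omega> \<in> space M. \<forall>i\<le>n. X i \<omega> = x i} =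
    q $ x 0 * (\<Prod>i<n. P $ x i $ x (Suc i))"
  using assms by (induction n) (simp_all add: markov_chain_def)

text \<open>A path with one more time step is a shorter path together with its last state; this lets
  the last state be summed out first.\<close>

lemma sum_PiE_Suc:
  fixes h :: "(nat \<Rightarrow> 's::finite) \<Rightarrow> real"
  shows "(\<Sum>x\<in>PiE {..Suc n} (\<lambda>_. UNIV). h x) =
    (\<Sum>x\<in>PiE {..n} (\<lambda>_. UNIV). \<Sum>y\<in>UNIV. h (x(Suc n := y)))"
proof -
  let ?E = "PiE {..n} (\<lambda>_. UNIV :: 's set)"
  have "(\<Sum>x\<in>PiE {..Suc n} (\<lambda>_. UNIV). h x) = (\<Sum>(y, x)\<in>UNIV \<times> ?E. h (x(Suc n := y)))"
    unfolding atMost_Suc PiE_insert_eq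
    by (subst sum.reindex) (auto simp: split_def intro!: inj_combinator[simplified split_def])
  also have "\<dots> = (\<Sum>y\<in>UNIV. \<Sum>x\<in>?E. h (x(Suc n := y)))" by (simp add: sum.cartesian_product)
  also have "\<dots> = (\<Sum>x\<in>?E. \<Sum>y\<in>UNIV. h (x(Suc n := y)))" by (rule sum.swap)
  finally show ?thesis .
qed

text \<open>
  For the Markov chain, the left-hand side is the expectation of
  \<open>exp (\<theta> * (\<Sum>k=1..n. f (X k))) * v (X n)\<close>.
\<close>

lemma path_sum_eigen:
  fixes P :: "real^'s::finite^'s"
  assumes eig: "\<And>x. (\<Sum>y\<in>UNIV. P $ x $ y * exp (\<theta> * f y) * v y) = \<rho> * v x"
  shows "(\<Sum>x\<in>PiE {..n} (\<lambda>_. UNIV). q $ x 0 * (\<Prod>i<n. P $ x i $ x (Suc i)) *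
      exp (\<theta> * (\<Sum>k=1..n. f (x k))) * v (x n)) = \<rho> ^ n * (\<Sum>x\<in>UNIV. q $ x * v x)"
proof (induction n)
  case 0
  have "(\<Sum>x\<in>PiE {..0::nat} (\<lambda>_. UNIV). q $ x 0 * v (x 0)) = (\<Sum>x\<in>UNIV. q $ x * v x)"
    by (rule sum.reindex_bij_witness[of _ "\<lambda>x i. if i = 0 then x else undefined" "\<lambda>x. x 0"])
      (auto simp: PiE_def extensional_def fun_eq_iff)
  then show ?case by simp
next
  case (Suc n)
  let ?W = "\<lambda>x. q $ x 0 * (\<Prod>i<n. P $ x i $ x (Suc i)) * exp (\<theta> * (\<Sum>k=1..n. f (x k)))"
  \<comment> \<open>The weight \<open>?W\<close> reads only coordinates up to \<open>n\<close>, so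
    overriding coordinate \<open>Suc n\<close> leaves it unchanged.\<close>
  have upd: "?W (x(Suc n := y)) = ?W x" for x :: "nat \<Rightarrow> 's" and y
    by (auto intro!: arg_cong2[of _ _ _ _ "(*)"] prod.cong arg_cong[of _ _ exp] sum.cong)
  have "(\<Sum>x\<in>PiE {..Suc n} (\<lambda>_. UNIV). q $ x 0 * (\<Prod>i<Suc n. P $ x i $ x (Suc i)) *
        exp (\<theta> * (\<Sum>k=1..Suc n. f (x k))) * v (x (Suc n)))
      = (\<Sum>x\<in>PiE {..Suc n} (\<lambda>_. UNIV).
          ?W x * (P $ x n $ x (Suc n) * exp (\<theta> * f (x (Suc n))) * v (x (Suc n))))"
    by (simp add: distrib_left exp_add algebra_simps)
  also have "\<dots> = (\<Sum>x\<in>PiE {..n} (\<lambda>_. UNIV). \<Sum>y\<in>UNIV.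
      ?W x * (P $ x n $ y * exp (\<theta> * f y) * v y))"
    unfolding sum_PiE_Suc upd by simp
  also have "\<dots> = \<rho> * (\<Sum>x\<in>PiE {..n} (\<lambda>_. UNIV). ?W x * v (x n))"
    unfolding sum_distrib_left[symmetric] eig by (simp add: sum_distrib_left mult.left_commute)
  finally show ?case using Suc.IH by simp
qed

text \<open>The exponential Markov inequality, written as a finite sum over paths. The eigenvector
  is inserted through \<open>1 \<le> K * v (x n) / v m\<close> with \<open>v m\<close> maximal; the
  initial average of \<open>v\<close> is at most the same \<open>v m\<close>, so \<open>K\<close>
  enters only once.\<close>

lemma markov_chain_chernoff:
  fixes P :: "real^'s::finite^'s"
  assumes mc: "markov_chain M X q P" and q: "prob_vector q" and P: "\<And>x y. P $ x $ y \<ge> 0"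
    and v: "\<And>x. v x > 0" and ratio: "\<And>x y. v x / v y \<le> K"
    and eig: "\<And>x. (\<Sum>y\<in>UNIV. P $ x $ y * exp (\<theta> * f y) * v y) = \<rho> * v x"
    and \<theta>: "\<theta> \<ge> 0" and \<rho>: "\<rho> > 0" and n: "n \<ge> 1"
  shows "measure M {\<omega> \<in> space M. (1 / real n) * (\<Sum>k=1..n. f (X k \<omega>)) \<ge> \<mu>}
    \<le> K * exp (- (real n * (\<theta> * \<mu> - ln \<rho>)))"
proof -
  interpret prob_space M using mc by (simp add: markov_chain_def)
  have [measurable]: "X k \<in> measurable M (count_space UNIV)" for k
    using mc by (simp add: markov_chain_def)
  let ?E = "PiE {..n} (\<lambda>_. UNIV :: 's set)"
  let ?W = "\<lambda>x. q $ x 0 * (\<Prod>i<n. P $ x i $ x (Suc i))" and ?S = "\<lambda>x. \<Sum>k=1..n. f (x k)"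
  let ?C = "\<lambda>x. {\<omega> \<in> space M. \<forall>i\<le>n. X i \<omega> = x i}"
  have C: "?C x \<in> sets M" for x by measurable
  define I where "I = {x \<in> ?E. ?S x \<ge> real n * \<mu>}"
  have finE: "finite ?E" by (intro finite_PiE) auto
  then have finI: "finite I" by (simp add: I_def)
  have W: "?W x \<ge> 0" for x
    using q P by (auto simp: prob_vector_def intro!: mult_nonneg_nonneg prod_nonneg)
  have "Max (range v) \<in> range v" by (intro Max_in) auto
  then obtain m where m: "Max (range v) = v m" by blast
  have vm: "v x \<le> v m" for x unfolding m[symmetric] by (intro Max_ge) auto
  have K: "K \<ge> 0" using ratio[of m m] v[of m] by simp
  have "measure M {\<omega> \<in> space M. (1 / real n) * (\<Sum>k=1..n. f (X k \<omega>)) \<ge> \<mu>}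
      \<le> measure M (\<Union>x\<in>I. ?C x)"
  proof (rule finite_measure_mono)
    show "{\<omega> \<in> space M. (1 / real n) * (\<Sum>k=1..n. f (X k \<omega>)) \<ge> \<mu>} \<subseteq> (\<Union>x\<in>I. ?C x)"
    proof
      fix \<omega> assume \<omega>: "\<omega> \<in> {\<omega> \<in> space M. (1 / real n) * (\<Sum>k=1..n. f (X k \<omega>)) \<ge> \<mu>}"
      \<comment> \<open>Restricting the sample path to times up to \<open>n\<close> makes it an
        element of the finite extensional function space \<open>?E\<close>.\<close>
      let ?x = "\<lambda>i\<in>{..n}. X i \<omega>"
      have "?S ?x = (\<Sum>k=1..n. f (X k \<omega>))" by (intro sum.cong) auto
      then have "?x \<in> I" using \<omega> n by (auto simp: I_def field_simps)
      moreover have "\<omega> \<in> ?C ?x" using \<omega> by auto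
      ultimately show "\<omega> \<in> (\<Union>x\<in>I. ?C x)" by blast
    qed
    show "(\<Union>x\<in>I. ?C x) \<in> sets M" using finI C by (intro sets.finite_UN) auto
  qed
  also have "\<dots> \<le> (\<Sum>x\<in>I. measure M (?C x))"
    using finI C by (intro measure_subadditive_finite) (auto simp: emeasure_eq_measure)
  also have "\<dots> = (\<Sum>x\<in>I. ?W x)" by (simp add: markov_chain_path[OF mc])
  also have "\<dots> \<le> (\<Sum>x\<in>I. ?W x * (exp (\<theta> * (?S x - real n * \<mu>)) * (K * v (x n) / v m)))"
  proof (intro sum_mono)
    fix x assume "x \<in> I"
    then have "1 \<le> exp (\<theta> * (?S x - real n * \<mu>))" using \<theta> by (simp add: I_def)
    moreover have "1 \<le> K * v (x n) / v m"
      using ratio[of m "x n"] v[of m] v[of "x n"] by (simp add: field_simps)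
    ultimately have "1 * 1 \<le> exp (\<theta> * (?S x - real n * \<mu>)) * (K * v (x n) / v m)"
      by (intro mult_mono) auto
    then show "?W x \<le> ?W x * (exp (\<theta> * (?S x - real n * \<mu>)) * (K * v (x n) / v m))"
      using mult_left_mono[OF _ W[of x]] by fastforce
  qed
  \<comment> \<open>All terms are nonnegative, so the sum may be extended from the event to all
    paths, where \<open>path_sum_eigen\<close> evaluates it.\<close>
  also have "\<dots> \<le> (\<Sum>x\<in>?E. ?W x * (exp (\<theta> * (?S x - real n * \<mu>)) * (K * v (x n) / v m)))"
    using finE W K v by (intro sum_mono2) (auto simp: I_def less_imp_le)
  also have "\<dots> = exp (- (\<theta> * real n * \<mu>)) * (K / v m) *
      (\<Sum>x\<in>?E. ?W x * exp (\<theta> * ?S x) * v (x n))"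
    by (simp add: sum_distrib_left right_diff_distrib exp_diff exp_minus field_simps)
  also have "\<dots> = exp (- (\<theta> * real n * \<mu>)) * (K / v m) * (\<rho> ^ n * (\<Sum>x\<in>UNIV. q $ x * v x))"
    by (simp only: path_sum_eigen[OF eig])
  also have "\<dots> \<le> exp (- (\<theta> * real n * \<mu>)) * (K / v m) * (\<rho> ^ n * v m)"
  proof (intro mult_left_mono)
    have "(\<Sum>x\<in>UNIV. q $ x * v x) \<le> (\<Sum>x\<in>UNIV. q $ x * v m)"
      using q vm by (intro sum_mono mult_left_mono) (auto simp: prob_vector_def)
    also have "\<dots> = v m" using q by (simp add: prob_vector_def flip: sum_distrib_right)
    finally show "(\<Sum>x\<in>UNIV. q $ x * v x) \<le> v m" .
  qed (use K v \<rho> in \<open>auto simp: less_imp_le\<close>)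
  also have "\<dots> = K * (exp (- (\<theta> * real n * \<mu>)) * exp (real n * ln \<rho>))"
    using v[of m] \<rho> by (simp add: exp_of_nat_mult)
  also have "\<dots> = K * exp (- (real n * (\<theta> * \<mu> - ln \<rho>)))"
    unfolding exp_add[symmetric] by (simp add: algebra_simps)
  finally show ?thesis .
qed

text \<open>Passes from a bound for each \<theta> to the supremum, which may be infinite. For
  \<open>m = 0\<close> the right-hand side is nonnegative in any case; for \<open>m > 0\<close>
  taking logarithms bounds \<open>h\<close> uniformly, so the supremum is a real number obeying the
  same bound.\<close>

lemma le_exp_ereal_SUP:
  fixes h :: "real \<Rightarrow> real"
  assumes K: "K > 0" and m: "m \<ge> 0" and n: "n \<ge> (1::nat)"
    and le: "\<And>\<theta>. m \<le> K * exp (- (real n * h \<theta>))"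
  shows "ereal m \<le> ereal K * exp_ereal (- (ereal (real n) * (SUP \<theta>. ereal (h \<theta>))))"
proof (cases "m = 0")
  case True
  have "exp_ereal z \<ge> 0" for z by (cases z) (auto simp: exp_ereal_def)
  with True K show ?thesis by (simp add: ereal_0_le_mult flip: zero_ereal_def)
next
  case False
  with m have m: "m > 0" by simp
  have "ereal (h \<theta>) \<le> ereal (ln (K / m) / real n)" for \<theta>
  proof -
    have "ln m \<le> ln (K * exp (- (real n * h \<theta>)))" using le[of \<theta>] m by simp
    then have "real n * h \<theta> \<le> ln (K / m)" using K m by (simp add: ln_mult ln_div)
    then show ?thesis using n by (simp add: field_simps)
  qed
  then have up: "(SUP \<theta>. ereal (h \<theta>)) \<le> ereal (ln (K / m) / real n)" by (rule SUP_least)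
  \<comment> \<open>Any single value of \<open>h\<close> keeps the supremum away from minus
    infinity.\<close>
  have "ereal (h 0) \<le> (SUP \<theta>. ereal (h \<theta>))" by (rule SUP_upper) simp
  with up obtain s where s: "(SUP \<theta>. ereal (h \<theta>)) = ereal s"
    by (cases "SUP \<theta>. ereal (h \<theta>)") auto
  have "real n * s \<le> ln (K / m)" using up n by (simp add: s field_simps)
  then have "exp (- ln (K / m)) \<le> exp (- (real n * s))" by simp
  then have "m \<le> K * exp (- (real n * s))" using K m by (simp add: exp_minus field_simps)
  then show ?thesis by (simp add: s exp_ereal_def)
qed

theorem theorem1:
  fixes P :: "real^'s::finite^'s" and \<pi> :: "real^'s" and f :: "'s \<Rightarrow> real"
  assumes "stochastic_matrix P"
    and "irreducible_on UNIV P"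
    and "stationary_distribution P \<pi>"
    and "irreducible_on (argmax_set f) P"
    and "\<forall>x. x \<notin> argmax_set f \<longrightarrow> (\<exists>y\<in>argmax_set f. P $ x $ y > 0)"
  shows "\<bar>K_u P f\<bar> \<noteq> \<infinity> \<and>
    (\<forall>(M :: 'a measure) X q n \<mu>.
       prob_vector q \<longrightarrow> markov_chain M X q P \<longrightarrow> n \<ge> 1 \<longrightarrow> \<mu> \<ge> mean \<pi> f \<longrightarrow>
       ereal (measure M {\<omega> \<in> space M. (1 / real n) * (\<Sum>k=1..n. f (X k \<omega>)) \<ge> \<mu>})
         \<le> K_u P f * exp_ereal (- (ereal (real n) * rate_function P f \<mu>)))"
proof -
  let ?v = "\<lambda>\<theta> x. right_pf_vector (tilted P f \<theta>) $ x"
  obtain C where "\<And>\<theta> x y. \<theta> \<ge> 0 \<Longrightarrow> ?v \<theta> x / ?v \<theta> y \<le> C"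
    using right_pf_ratio_bounded[OF assms(1,2,4,5)] by metis
  then have "K_u P f \<le> ereal C" unfolding K_u_def by (intro SUP_least) auto
  moreover have ratio': "ereal (?v \<theta> x / ?v \<theta> y) \<le> K_u P f" if "\<theta> \<ge> 0" for \<theta> x y
    unfolding K_u_def using that by (intro SUP_upper2[of "(\<theta>, x, y)"]) auto
  ultimately obtain K where K: "K_u P f = ereal K"
    using ratio'[of 0 undefined undefined] by (cases "K_u P f") auto
  have ratio: "?v \<theta> x / ?v \<theta> y \<le> K" if "\<theta> \<ge> 0" for \<theta> x y
    using ratio'[OF that] by (simp add: K)
  note v = right_pf_tilted_pos[OF assms(1,2)]
  \<comment> \<open>The ratio of an entry to itself is 1.\<close>
  have "K \<ge> 1" using ratio[of 0 undefined undefined] v[of f 0 undefined] by simp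
  have "ereal (measure M {\<omega> \<in> space M. (1 / real n) * (\<Sum>k=1..n. f (X k \<omega>)) \<ge> \<mu>})
      \<le> K_u P f * exp_ereal (- (ereal (real n) * rate_function P f \<mu>))"
    if q: "prob_vector q" and mc: "markov_chain M X q P" and n: "n \<ge> 1" and \<mu>: "\<mu> \<ge> mean \<pi> f"
    for M :: "'a measure" and X q n \<mu>
    unfolding K rate_function_def
  proof (rule le_exp_ereal_SUP)
    fix \<theta> :: real
    let ?m = "measure M {\<omega> \<in> space M. (1 / real n) * (\<Sum>k=1..n. f (X k \<omega>)) \<ge> \<mu>}"
    show "?m \<le> K * exp (- (real n * (\<theta> * \<mu> - log_pf P f \<theta>)))"
    proof (cases "\<theta> \<ge> 0")
      case True
      show ?thesis
        unfolding log_pf_def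
        by (rule markov_chain_chernoff[OF mc q stochastic_matrix_nonneg[OF assms(1)] v ratio[OF True]
              right_pf_tilted_eigen[OF assms(1,2)] True spectral_radius_tilted_pos[OF assms(1,2)] n])
    next
      case False
      interpret prob_space M using mc by (simp add: markov_chain_def)
      \<comment> \<open>For negative \<theta> the exponent on the right is nonnegative, so the
        right-hand side is at least 1 and bounds any probability.\<close>
      have "\<theta> * \<mu> \<le> \<theta> * mean \<pi> f" using False \<mu> by simp
      also have "\<dots> \<le> log_pf P f \<theta>" by (rule log_pf_ge_mean[OF assms(1,2,3)])
      finally have "real n * (\<theta> * \<mu> - log_pf P f \<theta>) \<le> 0" by (simp add: mult_nonneg_nonpos)
      then have "1 * 1 \<le> K * exp (- (real n * (\<theta> * \<mu> - log_pf P f \<theta>)))"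
        using \<open>K \<ge> 1\<close> by (intro mult_mono) auto
      then show ?thesis using order_trans[OF prob_le_1] by simp
    qed
  qed (use \<open>K \<ge> 1\<close> n in auto)
  then show ?thesis by (simp add: K)
qed

end
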